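(* Let $(\Omega,\mu)$ be a probability space and let $f(\omega,x)$ be a real-valued function on $\Omega\times S^1$ with $f(\omega,\cdot)\in L^1(S^1)$ for a.e. $\omega\in\Omega$, with Fourier coefficients $c_n(\omega)$, $n\in\mathbb{Z}$. Write $\|c_n\|_\infty=\sup_{\omega\in\Omega}|c_n(\omega)|$. Suppose that $f$ is positive and that $\sum_{n\in\mathbb{Z}}\|c_n\|_\infty$ is finite. Let $T_n$ be the $n\times n$ random Toeplitz matrix with entries $(T_n)_{k,j}=c_{k-j}$, and let $S_n$ be the Strang circulant preconditioner of $T_n$. Then for all $\epsilon>0$ there exist $M$ and $N>0$ such that for all $n>N$, at most $M$ eigenvalue functions of $S_n-T_n$ have sup norms exceeding $\epsilon$.
   Context: Functions on $S^1$ are written as functions of the angle $x\in[-\pi,\pi]$, and $c_n(\omega)=\frac1{2\pi}\int_{-\pi}^{\pi}e^{-inx}f(\omega,x)\,dx$; the $c_n$ are random variables (defined for a.e. $\omega$, the supremum being taken over the $\omega$ where they are defined). The matrices $T_n$ are assumed Hermitian positive definite for a.e. $\omega$. The Strang preconditioner $S_n=(s_{k-j})_{0\le k,j\le n-1}$ is the Hermitian circulant matrix defined as follows. If $n=2m+1$: $s_\ell=c_\ell$ for $0\le\ell\le m$; $s_\ell=c_{\ell-n}$ for $m<\ell\le n-1$; $s_\ell=\overline{s_{-\ell}}$ for $0<-\ell\le n-1$. If $n=2m$: $s_\ell=c_\ell$ for $0\le\ell\le m-1$; $s_m$ is either $0$ or $\frac12(c_m+c_{-m})$; $s_\ell=c_{\ell-n}$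 for $m<\ell\le n-1$; $s_\ell=\overline{s_{-\ell}}$ for $0<-\ell\le n-1$. The eigenvalue functions of a Hermitian random $n\times n$ matrix $B(\omega)$ are the measurable functions $\lambda_1(\omega)\le\cdots\le\lambda_n(\omega)$ listing the eigenvalues of $B(\omega)$, with multiplicity, in increasing order for each $\omega$; the sup norm of $\lambda_k$ is $\sup_{\omega}|\lambda_k(\omega)|$. *)

theory Defs
  imports
    "HOL-Probability.Probability"
    "HOL-Computational_Algebra.Computational_Algebra"
    "Jordan_Normal_Form.Schur_Decomposition"
begin

(* HOL-Analysis notation that clashes with the matrix library *)
unbundle no vec_syntax
unbundle no inner_syntax

text \<open>
  The set of all \<open>\<omega>\<close> for which \<open>f \<omega>\<close> is in \<open>L\<^sup>1\<close> of the circle, that is, for which the Fourier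
  coefficients, and hence all matrices built from them, are defined.
\<close>

definition L1_domain :: "'w measure \<Rightarrow> ('w \<Rightarrow> real \<Rightarrow> real) \<Rightarrow> 'w set" where
  "L1_domain M f = {\<omega> \<in> space M. f \<omega> absolutely_integrable_on {-pi..pi}}"

definition fourier_coeff :: "(real \<Rightarrow> real) \<Rightarrow> int \<Rightarrow> complex" where
  "fourier_coeff g n =
     1 / (2 * pi) *
     (LINT x:{-pi..pi}|lebesgue. exp (- (\<i> * of_int n * of_real x)) * of_real (g x))"

text \<open>
  A true supremum, not an essential one, and extended-valued: it is \<open>\<infinity>\<close> for unbounded functions.
\<close>

definition sup_norm_on :: "'w set \<Rightarrow> ('w \<Rightarrow> 'b::real_normed_vector) \<Rightarrow> ennreal" where
  "sup_norm_on D g = (SUP \<omega>\<in>D. ennreal (norm (g \<omega>)))"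

definition toeplitz_mat :: "nat \<Rightarrow> (int \<Rightarrow> complex) \<Rightarrow> complex mat" where
  "toeplitz_mat n c = mat n n (\<lambda>(k, j). c (int k - int j))"

text \<open>
  For \<open>0 \<le> l < n\<close> the cases \<open>2 * l < n\<close>, \<open>2 * l = n\<close> and \<open>2 * l > n\<close> are \<open>l \<le> m\<close>, impossible,
  \<open>m < l\<close> when \<open>n = 2 * m + 1\<close>, and \<open>l \<le> m - 1\<close>, \<open>l = m\<close>, \<open>m < l\<close> when \<open>n = 2 * m\<close>.
  The flag \<open>avg\<close> selects between the two admissible values of the middle coefficient for even \<open>n\<close>:
  \<open>0\<close> or the average of \<open>c m\<close> and \<open>c (- m)\<close>.
\<close>

definition strang_coeff_nonneg :: "bool \<Rightarrow> nat \<Rightarrow> (int \<Rightarrow> complex) \<Rightarrow> int \<Rightarrow> complex" where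
  "strang_coeff_nonneg avg n c l =
     (if 2 * l < int n then c l
      else if 2 * l = int n then (if avg then (c l + c (- l)) / 2 else 0)
      else c (l - int n))"

definition strang_coeff :: "bool \<Rightarrow> nat \<Rightarrow> (int \<Rightarrow> complex) \<Rightarrow> int \<Rightarrow> complex" where
  "strang_coeff avg n c l =
     (if 0 \<le> l then strang_coeff_nonneg avg n c l
      else cnj (strang_coeff_nonneg avg n c (- l)))"

definition strang_mat :: "bool \<Rightarrow> nat \<Rightarrow> (int \<Rightarrow> complex) \<Rightarrow> complex mat" where
  "strang_mat avg n c = mat n n (\<lambda>(k, j). strang_coeff avg n c (int k - int j))"

definition hermitian_pos_def :: "complex mat \<Rightarrow> bool" where
  "hermitian_pos_def A \<longleftrightarrow>
     square_mat A \<and> mat_adjoint A = A \<and>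
     (\<forall>v \<in> carrier_vec (dim_row A). v \<noteq> 0\<^sub>v (dim_row A) \<longrightarrow> 0 < Re ((A *\<^sub>v v) \<bullet>c v))"

text \<open>
  The \<open>k\<close>-th eigenvalue function (\<open>k\<close> counted from \<open>0\<close>) of a Hermitian random matrix: for each
  \<open>\<omega>\<close> the entries are the roots of the characteristic polynomial, with multiplicity, in
  increasing order.  The roots are real for a Hermitian matrix, so that \<open>Re\<close> loses nothing.
  Being listed in increasing order determines these functions pointwise; their measurability
  is a consequence of that of the matrix entries.
\<close>

definition eigenvalue_fun :: "('w \<Rightarrow> complex mat) \<Rightarrow> nat \<Rightarrow> 'w \<Rightarrow> real" where
  "eigenvalue_fun B k \<omega> =
     sorted_list_of_multiset (image_mset Re (proots (char_poly (B \<omega>)))) ! k"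

end

theory Submission
  imports Defs
begin

text \<open>
  The matrix \<open>S\<^sub>n - T\<^sub>n\<close> is Hermitian Toeplitz; its \<open>l\<close>-th diagonal vanishes for \<open>2\<bar>l\<bar> < n\<close> and is
  otherwise at most \<open>\<bar>c\<^sub>l\<bar> + \<bar>c\<^bsub>l-n\<^esub>\<bar>\<close> (with \<open>l > 0\<close>).  Choose \<open>L\<close> such that the coefficients with
  index beyond \<open>L\<close> have total norm at most \<open>\<epsilon>/2\<close>, uniformly in \<open>\<omega>\<close>.  After deletion of the first
  and last \<open>L\<close> rows and columns every index that occurs is beyond \<open>L\<close>, so all row sums are at most \<open>\<epsilon>\<close>.
  Hence the quadratic form is bounded by \<open>\<epsilon>\<close> on a subspace of codimension \<open>2L\<close>, and by the
  min-max principle \<open>\<bar>\<lambda>\<^sub>k\<bar> \<le> \<epsilon>\<close> except for the \<open>2L\<close> smallest and the \<open>2L\<close> largest indices \<open>k\<close>.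
  These exceptional indices do not depend on \<open>\<omega>\<close>, which gives the bound \<open>4L\<close>.
\<close>

(* The power series notation $ clashes with that for vector entries. *)
unbundle no Formal_Power_Series.fps_syntax

section \<open>Adjoints of complex matrices and the norm of a vector\<close>

lemma mat_adjoint_eq_mat:
  "mat_adjoint A = mat (dim_col A) (dim_row A) (\<lambda>(i, j). conjugate (A $$ (j, i)))"
  unfolding mat_adjoint_def by (intro eq_matI) (auto simp: mat_of_rows_def)

lemma mat_adjoint_carrier: "A \<in> carrier_mat n m \<Longrightarrow> mat_adjoint A \<in> carrier_mat m n"
  by (auto simp: mat_adjoint_eq_mat)

lemma index_mat_adjoint:
  "A \<in> carrier_mat n m \<Longrightarrow> i < m \<Longrightarrow> j < n \<Longrightarrow> mat_adjoint A $$ (i, j) = conjugate (A $$ (j, i))"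
  by (auto simp: mat_adjoint_eq_mat)

lemma mat_adjoint_mult:
  fixes A B :: "complex mat"
  assumes A: "A \<in> carrier_mat n m" and B: "B \<in> carrier_mat m k"
  shows "mat_adjoint (A * B) = mat_adjoint B * mat_adjoint A"
proof (rule eq_matI)
  note AB = mult_carrier_mat[OF A B]
  note aA = mat_adjoint_carrier[OF A] and aB = mat_adjoint_carrier[OF B]
  fix i j
  assume "i < dim_row (mat_adjoint B * mat_adjoint A)" "j < dim_col (mat_adjoint B * mat_adjoint A)"
  then have i: "i < k" and j: "j < n" using aA aB by auto
  have "mat_adjoint (A * B) $$ (i, j) = cnj ((A * B) $$ (j, i))"
    using index_mat_adjoint[OF AB i j] by simp
  also have "\<dots> = (\<Sum>l<m. cnj (A $$ (j, l)) * cnj (B $$ (l, i)))"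
    using A B i j by (auto simp: scalar_prod_def atLeast0LessThan)
  also have "\<dots> = (mat_adjoint B * mat_adjoint A) $$ (i, j)"
    using A B aA aB i j
    by (auto simp: scalar_prod_def atLeast0LessThan index_mat_adjoint[OF A] index_mat_adjoint[OF B] mult.commute intro!: sum.cong)
  finally show "mat_adjoint (A * B) $$ (i, j) = (mat_adjoint B * mat_adjoint A) $$ (i, j)" .
qed (use mat_adjoint_carrier[OF A] mat_adjoint_carrier[OF B] mat_adjoint_carrier[OF mult_carrier_mat[OF A B]] in auto)

lemma mat_adjoint_adjoint:
  fixes A :: "complex mat"
  assumes A: "A \<in> carrier_mat n m"
  shows "mat_adjoint (mat_adjoint A) = A"
  using mat_adjoint_carrier[OF mat_adjoint_carrier[OF A]] A
  by (intro eq_matI) (auto simp: index_mat_adjoint[OF mat_adjoint_carrier[OF A]] index_mat_adjoint[OF A])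

lemma cscalar_prod_self:
  fixes w :: "complex vec"
  assumes "w \<in> carrier_vec n"
  shows "w \<bullet>c w = of_real (\<Sum>i<n. (cmod (w $ i))\<^sup>2)"
  using assms by (auto simp: scalar_prod_def atLeast0LessThan complex_norm_square simp del: of_real_power)

section \<open>Unitary triangularization and diagonalization of Hermitian matrices\<close>

text \<open>Induction on the dimension. A unit eigenvector is completed to an orthonormal basis; in
  that basis the first column is a multiple of the first unit vector, and the induction hypothesis
  triangularizes the remaining diagonal block. Unitarity of \<open>U\<close> is what later
  transports the quadratic form and the norm to the eigenbasis.\<close>

lemma unitary_schur_decomposition:
  fixes A :: "complex mat"
  assumes "A \<in> carrier_mat n n"
  shows "\<exists>B U. similar_mat_wit A B U (mat_adjoint U) \<and> upper_triangular B"
  using assms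
proof (induction n arbitrary: A)
  case 0
  \<comment> \<open>In dimension 0 the empty matrix serves both as the triangular factor and as the
    unitary one.\<close>
  then have "mat_adjoint A = A" "A = 1\<^sub>m 0"
    by (auto intro!: eq_matI simp: mat_adjoint_def)
  with 0 similar_mat_wit_refl[of A 0] show ?case
    by (intro exI[of _ A]) (auto simp: upper_triangular_def)
next
  case (Suc m A)
  let ?n = "Suc m"
  have A: "A \<in> carrier_mat ?n ?n" by fact
  have "degree (char_poly A) \<noteq> 0"
    using degree_monic_char_poly[OF A] by simp
  then obtain e where "poly (char_poly A) e = 0"
    using fundamental_theorem_of_algebra[of "char_poly A"] by (auto simp: constant_degree)
  then have "eigenvalue A e"
    using eigenvalue_root_char_poly[OF A] by simp
  then obtain v where v: "v \<in> carrier_vec ?n" and v0: "v \<noteq> 0\<^sub>v ?n" and ev: "A *\<^sub>v v = e \<cdot>\<^sub>v v"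
    using A unfolding eigenvalue_def eigenvector_def by auto
  interpret cof_vec_space ?n "TYPE(complex)" .
  define b where "b = basis_completion v"
  define ws where "ws = gram_schmidt ?n b"
  from basis_completion[OF v v0, folded b_def]
  have dist_b: "distinct b" and indep: "\<not> lin_dep (set b)" and b: "set b \<subseteq> carrier_vec ?n"
    and hdb: "hd b = v" and len_b: "length b = ?n" by auto
  from gram_schmidt_result[OF b dist_b indep refl, folded ws_def]
  have ws: "set ws \<subseteq> carrier_vec ?n" "corthogonal ws" "length ws = ?n"
    by (auto simp: len_b)
  from hdb len_b obtain vs where bv: "b = v # vs" by (cases b) auto
  from gram_schmidt_hd[OF v, of vs, folded bv] have hdws: "hd ws = v" unfolding ws_def .
  \<comment> \<open>Gram-Schmidt gives orthogonal vectors of arbitrary length. Division by the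
    length \<open>sqrt (N w)\<close> makes the change of basis unitary, and the first vector remains
    an eigenvector for \<open>e\<close>.\<close>
  define N where "N w = (\<Sum>i<?n. (cmod (w $ i))\<^sup>2)" for w :: "complex vec"
  define r where "r w = complex_of_real (1 / sqrt (N w))" for w
  define us where "us = map (\<lambda>w. r w \<cdot>\<^sub>v w) ws"
  have wsi: "ws ! i \<in> carrier_vec ?n" if "i < ?n" for i
    using ws that by auto
  have wN: "ws ! i \<bullet>c ws ! i = of_real (N (ws ! i))" if "i < ?n" for i
    unfolding N_def by (rule cscalar_prod_self[OF wsi[OF that]])
  have wpos: "0 < N (ws ! i)" if i: "i < ?n" for i
  proof -
    have "N (ws ! i) \<noteq> 0"
      using corthogonalD[OF ws(2), of i i] i ws(3) wN[OF i] by auto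
    moreover have "0 \<le> N (ws ! i)"
      unfolding N_def by (intro sum_nonneg) simp
    ultimately show ?thesis by linarith
  qed
  have prod_us: "us ! i \<bullet>c us ! j = r (ws ! i) * cnj (r (ws ! j)) * (ws ! i \<bullet>c ws ! j)"
    if "i < ?n" "j < ?n" for i j
    using that wsi[OF that(1)] wsi[OF that(2)] ws(3) by (simp add: us_def conjugate_smult_vec)
  have us: "set us \<subseteq> carrier_vec ?n" "length us = ?n"
    using ws by (auto simp: us_def)
  have unit: "us ! i \<bullet>c us ! i = 1" if i: "i < ?n" for i
  proof -
    have "1 / sqrt (N (ws ! i)) * (1 / sqrt (N (ws ! i))) * N (ws ! i) = 1"
      using wpos[OF i] by simp
    then show ?thesis
      unfolding prod_us[OF i i] wN[OF i] r_def complex_cnj_complex_of_real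
      by (metis of_real_mult of_real_1)
  qed
  have orth: "corthogonal us"
  proof (rule corthogonalI)
    fix i j assume "i < length us" "j < length us"
    then have i: "i < ?n" and j: "j < ?n" using us by auto
    have r0: "r (ws ! i) \<noteq> 0" "r (ws ! j) \<noteq> 0"
      using wpos[OF i] wpos[OF j] by (auto simp: r_def)
    show "(us ! i \<bullet>c us ! j = 0) = (i \<noteq> j)"
      unfolding prod_us[OF i j] using corthogonalD[OF ws(2), of i j] i j ws(3) r0 by auto
  qed
  define u where "u = hd us"
  have u_eq: "u = r v \<cdot>\<^sub>v v"
    using hdws ws(3) unfolding u_def us_def by (cases ws) auto
  have u0: "us ! 0 = u" using us(2) unfolding u_def by (cases us) auto
  have u: "u \<in> carrier_vec ?n" using v u_eq by auto
  have un0: "u \<noteq> 0\<^sub>v ?n"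
    using unit[of 0] u0 by auto
  have evu: "A *\<^sub>v u = e \<cdot>\<^sub>v u"
    unfolding u_eq mult_mat_vec[OF A v] ev by (simp add: smult_smult_assoc mult.commute)
  have col0: "col (corthogonal_inv (mat_of_cols ?n us) * A * mat_of_cols ?n us) 0
      = vec ?n (\<lambda>i. if i = 0 then e else 0)"
    by (rule corthogonal_col_ev_0[OF A u un0 evu _ u_def[symmetric] us(1) orth us(2)]) simp
  define W where "W = mat_of_cols ?n us"
  have W: "W \<in> carrier_mat ?n ?n"
    using us mat_of_cols_carrier(1)[of ?n us] unfolding W_def by auto
  \<comment> \<open>The rows of \<open>corthogonal_inv W\<close> are the conjugated columns of
    \<open>W\<close> divided by their squared lengths, which are 1 here.\<close>
  have inv_W: "corthogonal_inv W = mat_adjoint W"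
  proof -
    have "vec_inv x = conjugate x" if "x \<in> set us" for x
      using unit that us by (auto simp: vec_inv_def in_set_conv_nth)
    moreover have "cols W = us" unfolding W_def using us by simp
    ultimately show ?thesis unfolding corthogonal_inv_def mat_adjoint_def
      by (auto intro: arg_cong2[of _ _ _ _ mat_of_rows])
  qed
  note aW = mat_adjoint_carrier[OF W]
  define A' where "A' = mat_adjoint W * A * W"
  have A': "A' \<in> carrier_mat ?n ?n" using A W aW unfolding A'_def by auto
  have "corthogonal_mat W" unfolding W_def by (rule orthogonal_mat_of_cols[OF us(1) orth us(2)])
  from corthogonal_inv_result[OF this] have W'W: "mat_adjoint W * W = 1\<^sub>m ?n"
    using aW by (simp add: inv_W inverts_mat_def)
  have WW': "W * mat_adjoint W = 1\<^sub>m ?n"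
    using mat_mult_left_right_inverse[OF aW W W'W] .
  have sim1: "similar_mat_wit A A' W (mat_adjoint W)"
  proof -
    have "similar_mat_wit A' A (mat_adjoint W) W"
      by (rule similar_mat_witI[of _ _ ?n]) (use A A' W aW W'W WW' in \<open>auto simp: A'_def\<close>)
    then show ?thesis by (rule similar_mat_wit_sym)
  qed
  have col0': "col A' 0 = vec ?n (\<lambda>i. if i = 0 then e else 0)"
    using col0 unfolding A'_def inv_W[symmetric] by (simp only: W_def)
  obtain A1 A2 A0 A3 where split: "split_block A' 1 1 = (A1,A2,A0,A3)"
    by (cases "split_block A' 1 1") auto
  have dims: "dim_row A' = 1 + m" "dim_col A' = 1 + m" using A' by auto
  from split_block[OF split dims] have A1: "A1 \<in> carrier_mat 1 1" and A2: "A2 \<in> carrier_mat 1 m"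
    and A3: "A3 \<in> carrier_mat m m" and blk: "A' = four_block_mat A1 A2 A0 A3" by auto
  \<comment> \<open>The first column of \<open>A'\<close> is zero below its corner entry
    \<open>e\<close>.\<close>
  have A0: "A0 = 0\<^sub>m m 1"
  proof -
    have "A' $$ (Suc i, 0) = 0" if "i < m" for i
      using arg_cong[OF col0', of "\<lambda>v. v $ Suc i"] that A'
      by auto
    then show ?thesis
      using split[unfolded split_block_def Let_def] A' by auto
  qed
  obtain B U where IH: "similar_mat_wit A3 B U (mat_adjoint U)" and ut: "upper_triangular B"
    using Suc.IH[OF A3] by blast
  from similar_mat_witD2[OF A3 IH] have B: "B \<in> carrier_mat m m" and U: "U \<in> carrier_mat m m"
    and UU: "U * mat_adjoint U = 1\<^sub>m m" by auto
  note aU = mat_adjoint_carrier[OF U]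
  \<comment> \<open>The unitary matrix of the smaller block, acting trivially on the first
    coordinate.\<close>
  let ?U = "four_block_mat (1\<^sub>m 1) (0\<^sub>m 1 m) (0\<^sub>m m 1) U"
  have U1: "?U \<in> carrier_mat ?n ?n"
    by (rule carrier_matI) (use U in auto)
  have aU1: "mat_adjoint ?U = four_block_mat (1\<^sub>m 1) (0\<^sub>m 1 m) (0\<^sub>m m 1) (mat_adjoint U)"
    using U by (intro eq_matI) (auto simp: mat_adjoint_eq_mat)
  have "similar_mat_wit A' (four_block_mat A1 (A2 * U) A0 B) ?U (mat_adjoint ?U)"
    unfolding blk aU1
    by (rule similar_mat_wit_four_block[OF similar_mat_wit_refl[OF A1] IH _ _ A1 A3])
      (use A0 A2 U aU UU in auto)
  from similar_mat_wit_trans[OF sim1 this]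
  have "similar_mat_wit A (four_block_mat A1 (A2 * U) A0 B) (W * ?U) (mat_adjoint (W * ?U))"
    unfolding mat_adjoint_mult[OF W U1] .
  moreover have "upper_triangular (four_block_mat A1 (A2 * U) A0 B)"
    unfolding A0 by (rule upper_triangular_four_block[OF A1 B _ ut]) (use A1 in auto)
  ultimately show ?case by blast
qed

text \<open>Unitary conjugation preserves being Hermitian, and a Hermitian upper triangular matrix
  is diagonal with real diagonal.\<close>

lemma hermitian_unitary_diagonalization:
  fixes A :: "complex mat"
  assumes A: "A \<in> carrier_mat n n" and herm: "mat_adjoint A = A"
  obtains B U where "similar_mat_wit A B U (mat_adjoint U)" "diagonal_mat B" 
    "\<And>i. i < n \<Longrightarrow> B $$ (i, i) = of_real (Re (B $$ (i, i)))"
proof -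
  obtain B U where sim: "similar_mat_wit A B U (mat_adjoint U)" and ut: "upper_triangular B"
    using unitary_schur_decomposition[OF A] by blast
  from similar_mat_witD2[OF A sim] have B: "B \<in> carrier_mat n n" and U: "U \<in> carrier_mat n n"
    and aU: "mat_adjoint U \<in> carrier_mat n n" by auto
  from similar_mat_witD2[OF B similar_mat_wit_sym[OF sim]] have "B = mat_adjoint U * A * U" by auto
  then have BU: "B = mat_adjoint U * (A * U)"
    by (simp add: assoc_mult_mat[OF aU A U])
  have "mat_adjoint B = mat_adjoint (A * U) * U"
    unfolding BU by (simp add: mat_adjoint_mult[OF aU mult_carrier_mat[OF A U]] mat_adjoint_adjoint[OF U])
  also have "\<dots> = mat_adjoint U * A * U"
    unfolding mat_adjoint_mult[OF A U] herm ..
  finally have "mat_adjoint B = B"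
    using BU by (simp add: assoc_mult_mat[OF aU A U])
  then have cnjB: "cnj (B $$ (j, i)) = B $$ (i, j)" if "i < n" "j < n" for i j
    using index_mat_adjoint[OF B that] by simp
  have "diagonal_mat B"
    unfolding diagonal_mat_def
  proof (intro allI impI)
    fix i j assume ij: "i < dim_row B" "j < dim_col B" "i \<noteq> j"
    then consider "j < i" | "i < j" by linarith
    then show "B $$ (i, j) = 0"
      using ut cnjB[of i j] ij B unfolding upper_triangular_def by cases auto
  qed
  moreover have "B $$ (i, i) = of_real (Re (B $$ (i, i)))" if "i < n" for i
    using cnjB[OF that that] by (simp add: complex_eq_iff)
  ultimately show thesis using that sim by blast
qed

section \<open>Min-max principle: from bounds on a quadratic form to bounds on ordered
  eigenvalues\<close>

text \<open>A homogeneous linear system with fewer equations than unknowns, solved by Gaussian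
  elimination: an equation with a nonzero coefficient removes one unknown, and one without is
  vacuous.\<close>

lemma exists_nonzero_solution:
  fixes a :: "'a \<Rightarrow> 'b \<Rightarrow> 'c :: field"
  assumes "finite C" "finite I" "card C < card I"
  shows "\<exists>y. (\<exists>i\<in>I. y i \<noteq> 0) \<and> (\<forall>t\<in>C. (\<Sum>i\<in>I. a t i * y i) = 0)"
  using assms
proof (induction C arbitrary: I a rule: finite_induct)
  case empty
  then show ?case by (intro exI[of _ "\<lambda>_. 1"]) (auto simp: card_gt_0_iff)
next
  case (insert s C)
  show ?case
  proof (cases "\<forall>i\<in>I. a s i = 0")
    case True
    have "card C < card I" using insert by simp
    from insert.IH[OF insert.prems(1) this] obtain y
      where "\<exists>i\<in>I. y i \<noteq> 0" "\<forall>t\<in>C. (\<Sum>i\<in>I. a t i * y i) = 0" by blast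
    with True show ?thesis by (intro exI[of _ y]) auto
  next
    case False
    then obtain p where p: "p \<in> I" "a s p \<noteq> 0" by auto
    \<comment> \<open>The coefficients of the remaining equations after equation \<open>s\<close>
      has been used to eliminate the unknown \<open>p\<close>.\<close>
    define b where "b t i = a t i - a t p * a s i / a s p" for t i
    have "card C < card (I - {p})" using insert p by simp
    from insert.IH[OF _ this, of b] insert.prems(1) obtain y
      where y: "\<exists>i\<in>I - {p}. y i \<noteq> 0" "\<And>t. t \<in> C \<Longrightarrow> (\<Sum>i\<in>I - {p}. b t i * y i) = 0"
      by blast
    \<comment> \<open>Back substitution: the value at \<open>p\<close> is the one that solves
      equation \<open>s\<close>.\<close>
    define x where "x = y(p := - (\<Sum>i\<in>I - {p}. a s i * y i) / a s p)"
    have split: "(\<Sum>i\<in>I. a t i * x i) = a t p * x p + (\<Sum>i\<in>I - {p}. a t i * y i)" for t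
      using insert.prems p by (subst sum.remove[of I p]) (auto simp: x_def intro!: sum.cong)
    have "(\<Sum>i\<in>I. a s i * x i) = 0"
      unfolding split using p by (simp add: x_def)
    moreover have "(\<Sum>i\<in>I. a t i * x i) = 0" if "t \<in> C" for t
    proof -
      have "(\<Sum>i\<in>I - {p}. b t i * y i) = (\<Sum>i\<in>I - {p}. a t i * y i - a t p / a s p * (a s i * y i))"
        by (simp add: b_def algebra_simps)
      also have "\<dots> = (\<Sum>i\<in>I - {p}. a t i * y i) - a t p / a s p * (\<Sum>i\<in>I - {p}. a s i * y i)"
        by (simp add: sum_subtractf sum_distrib_left)
      also have "\<dots> = (\<Sum>i\<in>I. a t i * x i)"
        unfolding split by (simp add: x_def)
      finally show ?thesis using y(2)[OF that] by simp
    qed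
    moreover have "\<exists>i\<in>I. x i \<noteq> 0" using y(1) by (auto simp: x_def)
    ultimately show ?thesis by blast
  qed
qed

lemma cscalar_prod_adjoint:
  fixes A :: "complex mat"
  assumes A: "A \<in> carrier_mat n m" and x: "x \<in> carrier_vec m" and y: "y \<in> carrier_vec n"
  shows "(A *\<^sub>v x) \<bullet>c y = x \<bullet>c (mat_adjoint A *\<^sub>v y)"
proof -
  note aA = mat_adjoint_carrier[OF A]
  have "(A *\<^sub>v x) \<bullet>c y = (\<Sum>i<n. \<Sum>j<m. A $$ (i, j) * x $ j * cnj (y $ i))"
    using A x y by (auto simp: scalar_prod_def atLeast0LessThan sum_distrib_right)
  also have "\<dots> = (\<Sum>j<m. \<Sum>i<n. A $$ (i, j) * x $ j * cnj (y $ i))"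
    by (rule sum.swap)
  also have "\<dots> = x \<bullet>c (mat_adjoint A *\<^sub>v y)"
    using A aA x y by (auto simp: scalar_prod_def atLeast0LessThan sum_distrib_left index_mat_adjoint[OF A]
        intro!: sum.cong)
  finally show ?thesis .
qed

text \<open>The eigenvectors in question span a space that, for reasons of dimension, meets
  the space of vectors vanishing on \<open>C\<close>.\<close>
lemma card_diagonal_gt_le:
  fixes A B U :: "complex mat" and d :: "nat \<Rightarrow> real"
  assumes A: "A \<in> carrier_mat n n"
    and sim: "similar_mat_wit A B U (mat_adjoint U)"
    and diag: "diagonal_mat B" and d: "\<And>i. i < n \<Longrightarrow> B $$ (i, i) = of_real (d i)"
    and C: "finite C"
    and form: "\<And>x. x \<in> carrier_vec n \<Longrightarrow> (\<And>i. i \<in> C \<Longrightarrow> i < n \<Longrightarrow> x $ i = 0) \<Longrightarrow>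
        s * Re ((A *\<^sub>v x) \<bullet>c x) \<le> \<epsilon> * Re (x \<bullet>c x)"
  shows "card {i. i < n \<and> \<epsilon> < s * d i} \<le> card C"
proof (rule ccontr)
  define I where "I = {i. i < n \<and> \<epsilon> < s * d i}"
  assume "\<not> card {i. i < n \<and> \<epsilon> < s * d i} \<le> card C"
  then have "card C < card I" by (simp add: I_def)
  \<comment> \<open>The conditions of vanishing at the indices in \<open>C\<close> are
    \<open>card C\<close> equations for the more numerous coefficients along the columns of
    \<open>U\<close> indexed by \<open>I\<close>.\<close>
  then obtain y0 where y0: "\<exists>i\<in>I. y0 i \<noteq> 0" "\<And>t. t \<in> C \<Longrightarrow> (\<Sum>i\<in>I. U $$ (t, i) * y0 i) = 0"
    using exists_nonzero_solution[OF C, of I "\<lambda>t i. U $$ (t, i)"] by (auto simp: I_def)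
  define y where "y = vec n (\<lambda>i. if i \<in> I then y0 i else 0)"
  have y: "y \<in> carrier_vec n" by (simp add: y_def)
  from similar_mat_witD2[OF A sim] have B: "B \<in> carrier_mat n n" and U: "U \<in> carrier_mat n n"
    and aU: "mat_adjoint U \<in> carrier_mat n n" and UU: "mat_adjoint U * U = 1\<^sub>m n"
    and AB: "A = U * B * mat_adjoint U" by auto
  define x where "x = U *\<^sub>v y"
  have x: "x \<in> carrier_vec n" using U y by (simp add: x_def)
  have Ux: "mat_adjoint U *\<^sub>v x = y"
    unfolding x_def using assoc_mult_mat_vec[OF aU U y] y by (simp add: UU)
  have "x $ t = 0" if "t \<in> C" "t < n" for t
  proof -
    have "x $ t = (\<Sum>i<n. U $$ (t, i) * y $ i)"
      using U y that by (simp add: x_def scalar_prod_def atLeast0LessThan)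
    also have "\<dots> = (\<Sum>i<n. if i \<in> I then U $$ (t, i) * y0 i else 0)"
      by (intro sum.cong) (auto simp: y_def)
    also have "\<dots> = (\<Sum>i\<in>I. U $$ (t, i) * y0 i)"
      by (intro sum.mono_neutral_cong_right) (auto simp: I_def)
    finally show ?thesis using y0(2)[OF that(1)] by simp
  qed
  from form[OF x this] have le: "s * Re ((A *\<^sub>v x) \<bullet>c x) \<le> \<epsilon> * Re (x \<bullet>c x)" .
  \<comment> \<open>In the coordinates \<open>y\<close> the form is diagonal with coefficients
    \<open>d i\<close>, while the norm is unchanged because \<open>U\<close> is unitary.\<close>
  have By: "(B *\<^sub>v y) $ i = of_real (d i) * y $ i" if i: "i < n" for i
  proof -
    have "(B *\<^sub>v y) $ i = (\<Sum>j<n. B $$ (i, j) * y $ j)"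
      using B y i by (simp add: scalar_prod_def atLeast0LessThan)
    also have "\<dots> = (\<Sum>j<n. if j = i then B $$ (i, i) * y $ i else 0)"
      using diag B i by (intro sum.cong) (auto simp: diagonal_mat_def)
    finally show ?thesis using i d[OF i] by simp
  qed
  have "A *\<^sub>v x = U *\<^sub>v (B *\<^sub>v y)"
    unfolding AB assoc_mult_mat_vec[OF mult_carrier_mat[OF U B] aU x] Ux
    by (rule assoc_mult_mat_vec[OF U B y])
  then have "(A *\<^sub>v x) \<bullet>c x = (B *\<^sub>v y) \<bullet>c y"
    using cscalar_prod_adjoint[OF U _ x, of "B *\<^sub>v y"] B y by (simp add: Ux)
  also have "\<dots> = (\<Sum>i<n. of_real (d i * (cmod (y $ i))\<^sup>2))"
    using B y by (auto simp: scalar_prod_def atLeast0LessThan By complex_norm_square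
        simp del: of_real_power index_mult_mat_vec intro!: sum.cong)
  finally have Ax: "s * Re ((A *\<^sub>v x) \<bullet>c x) = (\<Sum>i<n. s * d i * (cmod (y $ i))\<^sup>2)"
    by (simp add: sum_distrib_left mult.assoc)
  have "x \<bullet>c x = y \<bullet>c y"
    using cscalar_prod_adjoint[OF U y x] by (simp add: Ux flip: x_def)
  then have xx: "\<epsilon> * Re (x \<bullet>c x) = (\<Sum>i<n. \<epsilon> * (cmod (y $ i))\<^sup>2)"
    by (simp add: cscalar_prod_self[OF y] sum_distrib_left)
  from y0(1) obtain p where p: "p \<in> I" "y0 p \<noteq> 0" by auto
  \<comment> \<open>Outside \<open>I\<close> both terms are 0 since \<open>y\<close> vanishes there;
    inside \<open>I\<close> the comparison holds by choice of \<open>I\<close>, strictly at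
    \<open>p\<close>.\<close>
  have "(\<Sum>i<n. \<epsilon> * (cmod (y $ i))\<^sup>2) < (\<Sum>i<n. s * d i * (cmod (y $ i))\<^sup>2)"
  proof (rule sum_strict_mono_ex1)
    show "\<forall>i\<in>{..<n}. \<epsilon> * (cmod (y $ i))\<^sup>2 \<le> s * d i * (cmod (y $ i))\<^sup>2"
    proof
      fix i assume "i \<in> {..<n}"
      then show "\<epsilon> * (cmod (y $ i))\<^sup>2 \<le> s * d i * (cmod (y $ i))\<^sup>2"
        by (cases "i \<in> I") (auto simp: y_def I_def intro!: mult_right_mono)
    qed
    show "\<exists>i\<in>{..<n}. \<epsilon> * (cmod (y $ i))\<^sup>2 < s * d i * (cmod (y $ i))\<^sup>2"
      using p by (intro bexI[of _ p]) (auto simp: y_def I_def)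
  qed auto
  with le Ax xx show False by simp
qed

text \<open>If entry \<open>k\<close> exceeded \<open>e\<close>, so would the
  \<open>length xs - k\<close> entries from there on. This turns a count of large eigenvalues into a
  bound at a fixed position.\<close>

lemma sorted_nth_le:
  fixes xs :: "real list"
  assumes "sorted xs" "k < length xs" "length (filter (\<lambda>x. e < x) xs) < length xs - k"
  shows "xs ! k \<le> e"
proof (rule ccontr)
  assume "\<not> xs ! k \<le> e"
  then have "e < xs ! i" if "k \<le> i" "i < length xs" for i
    using sorted_nth_mono[OF assms(1) that] by linarith
  then have "{k..<length xs} \<subseteq> {i. i < length xs \<and> e < xs ! i}" by auto
  then have "card {k..<length xs} \<le> card {i. i < length xs \<and> e < xs ! i}"
    by (intro card_mono) auto
  with assms(3) show False by (simp add: length_filter_conv_card)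
qed

lemma sorted_nth_ge:
  fixes xs :: "real list"
  assumes "sorted xs" "k < length xs" "length (filter (\<lambda>x. x < e) xs) \<le> k"
  shows "e \<le> xs ! k"
proof (rule ccontr)
  assume "\<not> e \<le> xs ! k"
  then have "xs ! i < e" if "i \<le> k" for i
    using sorted_nth_mono[OF assms(1) that assms(2)] by linarith
  then have "{..k} \<subseteq> {i. i < length xs \<and> xs ! i < e}" using assms(2) by auto
  then have "card {..k} \<le> card {i. i < length xs \<and> xs ! i < e}"
    by (intro card_mono) auto
  with assms(3) show False by (simp add: length_filter_conv_card)
qed

lemma proots_linear_factors:
  fixes xs :: "'a :: idom list"
  shows "proots (\<Prod>a\<leftarrow>xs. [:- a, 1:]) = mset xs"
proof (induction xs)
  case (Cons a xs)
  have "(\<Prod>a\<leftarrow>xs. [:- a, 1:]) \<noteq> 0" by (auto simp: prod_list_zero_iff)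
  with Cons show ?case by (simp add: proots_mult del: mult_pCons_left)
qed simp

text \<open>At most \<open>card C\<close> eigenvalues lie above \<open>\<epsilon>\<close> and at
  most \<open>card C\<close> below \<open>- \<epsilon>\<close>, so only positions near the two ends
  of the sorted list can be affected. Which positions these are depends on \<open>card C\<close> and
  \<open>n\<close> alone, not on \<open>\<omega>\<close>.\<close>

lemma middle_eigenvalue_bound:
  fixes F :: "'w \<Rightarrow> complex mat"
  assumes A: "F \<omega> \<in> carrier_mat n n" and herm: "mat_adjoint (F \<omega>) = F \<omega>" and C: "finite C"
    and form: "\<And>x. x \<in> carrier_vec n \<Longrightarrow> (\<And>i. i \<in> C \<Longrightarrow> i < n \<Longrightarrow> x $ i = 0) \<Longrightarrow>
        cmod ((F \<omega> *\<^sub>v x) \<bullet>c x) \<le> \<epsilon> * Re (x \<bullet>c x)"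
    and k: "card C \<le> k" "k + card C < n"
  shows "\<bar>eigenvalue_fun F k \<omega>\<bar> \<le> \<epsilon>"
proof -
  obtain B U where sim: "similar_mat_wit (F \<omega>) B U (mat_adjoint U)" and diag: "diagonal_mat B"
    and real: "\<And>i. i < n \<Longrightarrow> B $$ (i, i) = of_real (Re (B $$ (i, i)))"
    using hermitian_unitary_diagonalization[OF A herm] by blast
  have B: "B \<in> carrier_mat n n" using similar_mat_witD2[OF A sim] by auto
  have "upper_triangular B"
    using diag B by (auto simp: upper_triangular_def diagonal_mat_def)
  have "char_poly (F \<omega>) = char_poly B"
    using sim by (intro char_poly_similar) (auto simp: similar_mat_def)
  also have "\<dots> = (\<Prod>a\<leftarrow>diag_mat B. [:- a, 1:])"
    by (rule char_poly_upper_triangular[OF B]) fact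
  finally have roots: "proots (char_poly (F \<omega>)) = mset (diag_mat B)"
    by (simp add: proots_linear_factors)
  define ds where "ds = map (\<lambda>i. Re (B $$ (i, i))) [0..<n]"
  have ev: "eigenvalue_fun F k \<omega> = sort ds ! k"
    using B unfolding eigenvalue_fun_def roots
    by (simp add: ds_def diag_mat_def comp_def flip: mset_map)
  have count: "length (filter P (sort ds)) = card {i. i < n \<and> P (Re (B $$ (i, i)))}" for P
  proof -
    have "length (filter P (sort ds)) = length (filter P ds)"
      by (metis mset_filter mset_sort size_mset)
    also have "\<dots> = card {i. i < n \<and> P (Re (B $$ (i, i)))}"
      unfolding length_filter_conv_card by (intro arg_cong[of _ _ card]) (auto simp: ds_def)
    finally show ?thesis .
  qed
  \<comment> \<open>The signs \<open>s = 1\<close> and \<open>s = - 1\<close> of the counting lemma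
    treat the upper and the lower end of the spectrum.\<close>
  have "card {i. i < n \<and> \<epsilon> < 1 * Re (B $$ (i, i))} \<le> card C"
    using form by (intro card_diagonal_gt_le[OF A sim diag real C]) (auto intro: order_trans[OF complex_Re_le_cmod])
  moreover have "card {i. i < n \<and> \<epsilon> < - 1 * Re (B $$ (i, i))} \<le> card C"
    using form abs_Re_le_cmod
    by (intro card_diagonal_gt_le[OF A sim diag real C]) (smt (verit, best))+
  ultimately have "length (filter (\<lambda>x. \<epsilon> < x) (sort ds)) \<le> card C"
    "length (filter (\<lambda>x. x < - \<epsilon>) (sort ds)) \<le> card C"
    unfolding count by (simp_all add: less_minus_iff)
  moreover have "length (sort ds) = n" by (simp add: ds_def)
  \<comment> \<open>As \<open>k\<close> counts from 0, there are \<open>n - k\<close> entries from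
    position \<open>k\<close> on, which must be more than \<open>card C\<close>, but
    \<open>k + 1\<close> up to position \<open>k\<close>, so that \<open>card C \<le> k\<close>
    suffices.\<close>
  ultimately have "sort ds ! k \<le> \<epsilon>" "- \<epsilon> \<le> sort ds ! k"
    using k by (auto intro!: sorted_nth_le sorted_nth_ge)
  then show ?thesis unfolding ev by linarith
qed

section \<open>Analytic estimates: row sums, Fourier coefficients and tails\<close>

text \<open>The Schur test. The product \<open>cmod (x $ j) * cmod (x $ k)\<close> is at most the
  mean of the two squares, and since the moduli of the entries are symmetric, each half contributes
  half of the row sums.\<close>

lemma hermitian_form_le_row_sums:
  fixes A :: "complex mat"
  assumes A: "A \<in> carrier_mat n n" and herm: "mat_adjoint A = A" and J: "J \<subseteq> {..<n}"
    and row: "\<And>k. k \<in> J \<Longrightarrow> (\<Sum>j\<in>J. cmod (A $$ (k, j))) \<le> \<epsilon>"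
    and x: "x \<in> carrier_vec n" and supp: "\<And>i. i < n \<Longrightarrow> i \<notin> J \<Longrightarrow> x $ i = 0"
  shows "cmod ((A *\<^sub>v x) \<bullet>c x) \<le> \<epsilon> * Re (x \<bullet>c x)"
proof -
  define q where "q i = (cmod (x $ i))\<^sup>2" for i
  define a where "a k j = cmod (A $$ (k, j))" for k j
  have sym: "a k j = a j k" if "k \<in> J" "j \<in> J" for k j
  proof -
    have "k < n" "j < n" using that J by auto
    then have "A $$ (k, j) = cnj (A $$ (j, k))"
      using index_mat_adjoint[OF A, of k j] herm by simp
    then show ?thesis by (simp add: a_def)
  qed
  have "(A *\<^sub>v x) \<bullet>c x = (\<Sum>k<n. \<Sum>j<n. A $$ (k, j) * x $ j * cnj (x $ k))"
    using A x by (auto simp: scalar_prod_def atLeast0LessThan sum_distrib_right)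
  also have "\<dots> = (\<Sum>k<n. \<Sum>j\<in>J. A $$ (k, j) * x $ j * cnj (x $ k))"
    using J supp by (intro sum.cong refl sum.mono_neutral_right) auto
  also have "\<dots> = (\<Sum>k\<in>J. \<Sum>j\<in>J. A $$ (k, j) * x $ j * cnj (x $ k))"
    using J supp by (intro sum.mono_neutral_right) auto
  finally have "cmod ((A *\<^sub>v x) \<bullet>c x) \<le> (\<Sum>k\<in>J. \<Sum>j\<in>J. cmod (A $$ (k, j) * x $ j * cnj (x $ k)))"
    by (simp add: order_trans[OF norm_sum sum_mono[OF norm_sum]])
  also have "\<dots> \<le> (\<Sum>k\<in>J. \<Sum>j\<in>J. a k j * (q j / 2) + a k j * (q k / 2))"
  proof (intro sum_mono)
    fix k j
    have "cmod (x $ j) * cmod (x $ k) \<le> q j / 2 + q k / 2"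
      using sum_squares_bound[of "cmod (x $ j)" "cmod (x $ k)"] by (simp add: q_def)
    then have "a k j * (cmod (x $ j) * cmod (x $ k)) \<le> a k j * (q j / 2 + q k / 2)"
      by (intro mult_left_mono) (auto simp: a_def)
    then show "cmod (A $$ (k, j) * x $ j * cnj (x $ k)) \<le> a k j * (q j / 2) + a k j * (q k / 2)"
      by (simp add: norm_mult a_def algebra_simps)
  qed
  also have "\<dots> = (\<Sum>k\<in>J. \<Sum>j\<in>J. a k j * (q j / 2)) + (\<Sum>k\<in>J. \<Sum>j\<in>J. a k j * (q k / 2))"
    by (simp only: sum.distrib)
  \<comment> \<open>The half carrying \<open>q j\<close> involves column sums; interchanging the
    summations and using \<open>sym\<close> makes them row sums.\<close>
  also have "(\<Sum>k\<in>J. \<Sum>j\<in>J. a k j * (q j / 2)) = (\<Sum>j\<in>J. \<Sum>k\<in>J. a k j * (q j / 2))"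
    by (rule sum.swap)
  also have "(\<Sum>j\<in>J. \<Sum>k\<in>J. a k j * (q j / 2)) = (\<Sum>j\<in>J. \<Sum>k\<in>J. a j k * (q j / 2))"
    by (intro sum.cong refl) (simp add: sym)
  also have "(\<Sum>j\<in>J. \<Sum>k\<in>J. a j k * (q j / 2)) + (\<Sum>k\<in>J. \<Sum>j\<in>J. a k j * (q k / 2))
      = (\<Sum>k\<in>J. (\<Sum>j\<in>J. a k j) * q k)"
    by (simp add: sum_distrib_left mult.commute flip: sum.distrib)
  also have "\<dots> \<le> (\<Sum>k\<in>J. \<epsilon> * q k)"
    using row by (intro sum_mono mult_right_mono) (auto simp: a_def q_def)
  also have "\<dots> = (\<Sum>k<n. \<epsilon> * q k)"
    using J supp by (intro sum.mono_neutral_left) (auto simp: q_def)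
  also have "\<dots> = \<epsilon> * Re (x \<bullet>c x)"
    unfolding cscalar_prod_self[OF x] by (simp add: q_def sum_distrib_left)
  finally show ?thesis .
qed

text \<open>Since \<open>g\<close> is real-valued, conjugation affects only the exponential. It
  commutes with the integral, also where that takes its default value 0.\<close>

lemma fourier_coeff_uminus: "fourier_coeff g (- n) = cnj (fourier_coeff g n)"
proof -
  have "cnj (LINT x:{-pi..pi}|lebesgue. exp (- (\<i> * of_int n * of_real x)) * of_real (g x))
    = (LINT x:{-pi..pi}|lebesgue. cnj (exp (- (\<i> * of_int n * of_real x)) * of_real (g x)))"
    unfolding set_lebesgue_integral_def Bochner_Integration.integral_cnj[symmetric] by (simp only: complex_cnj_scaleR)
  then show ?thesis unfolding fourier_coeff_def by (simp add: exp_cnj)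
qed

text \<open>Some finite \<open>F\<close> carries the whole sum up to \<open>e\<close>, and every
  finite set of indices beyond those of \<open>F\<close> is disjoint from it. Applied to the sup
  norms, this yields one \<open>L\<close> for all \<open>\<omega>\<close>.\<close>

lemma ennreal_int_sum_tail:
  fixes a :: "int \<Rightarrow> ennreal"
  assumes "(\<Sum>\<^sub>\<infinity>i\<in>UNIV. a i) < \<infinity>" "0 < e"
  obtains L :: nat where "\<And>G. finite G \<Longrightarrow> (\<And>i. i \<in> G \<Longrightarrow> int L < \<bar>i\<bar>) \<Longrightarrow> (\<Sum>i\<in>G. a i) \<le> e"
proof -
  define s where "s = (\<Sum>\<^sub>\<infinity>i\<in>UNIV. a i)"
  have s: "s = (SUP F\<in>{F. finite F}. sum a F)"
    unfolding s_def by (subst nonneg_infsum_complete) simp_all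
  obtain F where F: "finite F" "s \<le> sum a F + e"
  \<comment> \<open>For \<open>s = 0\<close> truncated subtraction would make
    \<open>s - e < s\<close> false; the empty set works there.\<close>
  proof (cases "s = 0")
    case False
    with assms have "s - e < s" by (auto simp: s_def ennreal_between zero_less_iff_neq_zero)
    then obtain F where "finite F" "s - e < sum a F"
      unfolding s by (auto simp: less_SUP_iff)
    then show ?thesis using that by (metis add.commute ennreal_minus_le_iff less_imp_le)
  qed (use that[of "{}"] in simp)
  \<comment> \<open>For empty \<open>F\<close> this maximum is unspecified, which is harmless:
    \<open>L\<close> is only compared with elements of \<open>F\<close>.\<close>
  define L where "L = Max ((\<lambda>i. nat \<bar>i\<bar>) ` F)"
  have L: "\<bar>i\<bar> \<le> int L" if "i \<in> F" for i
  proof -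
    have "nat \<bar>i\<bar> \<le> L"
      unfolding L_def using F(1) that by (intro Max_ge) auto
    then show ?thesis by linarith
  qed
  have "(\<Sum>i\<in>G. a i) \<le> e" if G: "finite G" "\<And>i. i \<in> G \<Longrightarrow> int L < \<bar>i\<bar>" for G
  proof -
    have "F \<inter> G = {}" using G(2) L by force
    then have "sum a F + sum a G = sum a (F \<union> G)"
      using F G by (simp add: sum.union_disjoint)
    also have "\<dots> \<le> s" unfolding s using F G by (intro SUP_upper) auto
    also have "\<dots> \<le> sum a F + e" by (rule F)
    finally have "sum a F + sum a G \<le> sum a F + e" .
    \<comment> \<open>Cancelling \<open>sum a F\<close> in \<open>ennreal\<close> requires it to be
      finite.\<close>
    moreover have "sum a F \<le> s"
      unfolding s using F by (intro SUP_upper) auto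
    then have "sum a F \<noteq> \<infinity>"
      using assms(1) unfolding s_def by auto
    ultimately show ?thesis by (simp add: ennreal_add_left_cancel_le)
  qed
  then show thesis using that by blast
qed

section \<open>Entries and row sums of the difference of the Strang and Toeplitz matrices\<close>

definition strang_defect :: "bool \<Rightarrow> nat \<Rightarrow> (int \<Rightarrow> complex) \<Rightarrow> int \<Rightarrow> complex" where
  "strang_defect avg n c l = strang_coeff avg n c l - c l"

lemma strang_minus_toeplitz:
  "strang_mat avg n c - toeplitz_mat n c = mat n n (\<lambda>(k, j). strang_defect avg n c (int k - int j))"
  unfolding strang_mat_def toeplitz_mat_def strang_defect_def by (intro eq_matI) auto

context
  fixes c :: "int \<Rightarrow> complex"
  assumes c_uminus: "\<And>l. c (- l) = cnj (c l)"
begin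

text \<open>Below the middle the coefficients of \<open>c\<close> are copied; for negative
  \<open>l\<close> they are conjugated copies, which \<open>c_uminus\<close> identifies with
  \<open>c l\<close>.\<close>

lemma strang_defect_eq_0: "2 * \<bar>l\<bar> < int n \<Longrightarrow> strang_defect avg n c l = 0"
  by (cases "0 \<le> l") (simp_all add: strang_defect_def strang_coeff_def strang_coeff_nonneg_def c_uminus)

text \<open>Opposite indices are conjugate by construction. Index 0 is its own opposite, and
  \<open>0 < n\<close> places it where the defect vanishes.\<close>

lemma strang_defect_uminus: "0 < n \<Longrightarrow> strang_defect avg n c (- l) = cnj (strang_defect avg n c l)"
proof (cases l "0 :: int" rule: linorder_cases)
  case equal
  assume "0 < n"
  with equal show ?thesis by (simp add: strang_defect_eq_0)
qed (simp_all add: strang_defect_def strang_coeff_def c_uminus)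

text \<open>Past the middle, \<open>c l\<close> is replaced by the coefficient wrapped around by
  \<open>n\<close>. Negative indices follow by conjugation, whence the factor
  \<open>sgn l\<close>.\<close>

lemma norm_strang_defect_le:
  assumes "0 < n" "l \<noteq> 0"
  shows "cmod (strang_defect avg n c l) \<le> cmod (c l) + cmod (c (l - sgn l * int n))"
proof -
  have pos: "cmod (strang_defect avg n c l) \<le> cmod (c l) + cmod (c (l - int n))" if "0 < l" for l
  proof -
    consider "2 * l < int n" | "2 * l = int n" | "2 * l > int n" by linarith
    then show ?thesis
    proof cases
      case 2
      then have ln: "l - int n = - l" by simp
      have n: "cmod (c (l - int n)) = cmod (c l)"
        unfolding ln c_uminus by (rule complex_mod_cnj)
      \<comment> \<open>Either admissible middle coefficient leaves a defect of norm at most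
        \<open>cmod (c l)\<close>, because \<open>c (- l)\<close> and \<open>c l\<close> have equal
        norm.\<close>
      have eq: "strang_defect avg n c l = (if avg then (c (- l) - c l) / 2 else - c l)"
        using that 2 by (simp add: strang_defect_def strang_coeff_def strang_coeff_nonneg_def field_simps)
      have "cmod (c (- l) - c l) \<le> 2 * cmod (c l)"
        using norm_triangle_ineq4[of "c (- l)" "c l"] by (simp add: c_uminus)
      then have "cmod (strang_defect avg n c l) \<le> cmod (c l)"
        unfolding eq by (simp add: norm_divide)
      then show ?thesis unfolding n by (rule order_trans) simp
    next
      case 3
      then show ?thesis using that norm_triangle_ineq4[of "c (l - int n)" "c l"]
        by (simp add: strang_defect_def strang_coeff_def strang_coeff_nonneg_def)
    qed (use that strang_defect_eq_0[of l n] in auto)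
  qed
  show ?thesis
  proof (cases "0 < l")
    case False
    with assms have l: "0 < - l" by simp
    have "cmod (strang_defect avg n c l) = cmod (strang_defect avg n c (- l))"
      by (simp only: strang_defect_uminus[OF \<open>0 < n\<close>] complex_mod_cnj)
    moreover have "cmod (c (- l - int n)) = cmod (c (l - sgn l * int n))"
      using l c_uminus[of "l + int n"] by (simp add: sgn_if)
    ultimately show ?thesis using pos[OF l] by (simp add: c_uminus)
  qed (use pos in simp)
qed

text \<open>Where the defect need not vanish, \<open>\<bar>k - j\<bar>\<close> is at least
  \<open>n / 2\<close>, hence beyond \<open>L\<close>; and since it is less than
  \<open>n - 2 * L\<close> in the central block, the wrapped index is beyond \<open>L\<close> as
  well. Each of the two families of indices costs one tail \<open>e\<close>.\<close>

lemma strang_defect_row_sum: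
  assumes tail: "\<And>G. finite G \<Longrightarrow> (\<And>i. i \<in> G \<Longrightarrow> int L < \<bar>i\<bar>) \<Longrightarrow> (\<Sum>i\<in>G. cmod (c i)) \<le> e"
    and n: "2 * L < n" and k: "k \<in> {L..<n - L}"
  shows "(\<Sum>j\<in>{L..<n - L}. cmod (strang_defect avg n c (int k - int j))) \<le> 2 * e"
proof -
  define J where "J = {j \<in> {L..<n - L}. int n \<le> 2 * \<bar>int k - int j\<bar>}"
  define h where "h l = l - sgn l * int n" for l :: int
  let ?l = "\<lambda>j. int k - int j"
  have l: "?l j \<noteq> 0" "int L < \<bar>?l j\<bar>" "int L < \<bar>h (?l j)\<bar>" if "j \<in> J" for j
    using that k n by (auto simp: J_def h_def sgn_if)
  have inj1: "inj_on ?l J" by (auto simp: inj_on_def)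
  \<comment> \<open>Wrapping is a translation on the positive and on the negative differences, and
    it reverses the sign, so that the two images cannot meet.\<close>
  have inj2: "inj_on (\<lambda>j. h (?l j)) J"
    using k n by (auto simp: inj_on_def h_def sgn_if J_def split: if_splits)
  have "(\<Sum>j\<in>{L..<n - L}. cmod (strang_defect avg n c (?l j))) = (\<Sum>j\<in>J. cmod (strang_defect avg n c (?l j)))"
  proof (intro sum.mono_neutral_right ballI)
    fix j assume "j \<in> {L..<n - L} - J"
    then have "2 * \<bar>?l j\<bar> < int n" by (auto simp: J_def)
    then show "cmod (strang_defect avg n c (?l j)) = 0"
      by (simp only: strang_defect_eq_0 norm_zero)
  qed (auto simp: J_def)
  also have "\<dots> \<le> (\<Sum>j\<in>J. cmod (c (?l j)) + cmod (c (h (?l j))))"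
    using l(1) n unfolding h_def by (intro sum_mono norm_strang_defect_le) auto
  also have "\<dots> = (\<Sum>i\<in>?l ` J. cmod (c i)) + (\<Sum>i\<in>(\<lambda>j. h (?l j)) ` J. cmod (c i))"
    by (simp add: sum.distrib sum.reindex[OF inj1] sum.reindex[OF inj2])
  also have "\<dots> \<le> e + e"
    using l by (intro add_mono tail) (auto simp: J_def)
  finally show ?thesis by simp
qed

end

section \<open>Uniform bounds on the eigenvalue functions\<close>

lemma strang_middle_eigenvalue_bound:
  fixes c :: "int \<Rightarrow> 'w \<Rightarrow> complex"
  assumes c_uminus: "\<And>l. c (- l) \<omega> = cnj (c l \<omega>)"
    and tail: "\<And>G. finite G \<Longrightarrow> (\<And>i. i \<in> G \<Longrightarrow> int L < \<bar>i\<bar>) \<Longrightarrow> (\<Sum>i\<in>G. cmod (c i \<omega>)) \<le> e"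
    and k: "2 * L \<le> k" "k + 2 * L < n"
  shows "\<bar>eigenvalue_fun (\<lambda>\<omega>. strang_mat avg n (\<lambda>l. c l \<omega>) - toeplitz_mat n (\<lambda>l. c l \<omega>)) k \<omega>\<bar> \<le> 2 * e"
proof -
  let ?F = "\<lambda>\<omega>. strang_mat avg n (\<lambda>l. c l \<omega>) - toeplitz_mat n (\<lambda>l. c l \<omega>)"
  let ?b = "strang_defect avg n (\<lambda>l. c l \<omega>)"
  \<comment> \<open>The first and last \<open>L\<close> indices; vectors vanishing on
    \<open>C\<close> live on the central block, where the row sums are small.\<close>
  define C where "C = {..<L} \<union> {n - L..<n}"
  have F: "?F \<omega> = mat n n (\<lambda>(k, j). ?b (int k - int j))"
    by (rule strang_minus_toeplitz)
  have herm: "mat_adjoint (?F \<omega>) = ?F \<omega>"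
    unfolding F mat_adjoint_eq_mat using k strang_defect_uminus[of "\<lambda>l. c l \<omega>", OF c_uminus, of n avg]
    by (intro eq_matI) (auto, metis minus_diff_eq complex_cnj_cnj)
  have "card C \<le> L + L"
    unfolding C_def by (rule order_trans[OF card_Un_le]) simp
  with k have "card C \<le> k" "k + card C < n" by simp_all
  then show ?thesis
  proof (rule middle_eigenvalue_bound[rotated 4])
    show "?F \<omega> \<in> carrier_mat n n" unfolding F by simp
    show "mat_adjoint (?F \<omega>) = ?F \<omega>" by (rule herm)
    show "finite C" by (simp add: C_def)
    fix x :: "complex vec"
    assume x: "x \<in> carrier_vec n" and supp: "\<And>i. i \<in> C \<Longrightarrow> i < n \<Longrightarrow> x $ i = 0"
    show "cmod ((?F \<omega> *\<^sub>v x) \<bullet>c x) \<le> 2 * e * Re (x \<bullet>c x)"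
    proof (rule hermitian_form_le_row_sums[OF _ herm _ _ x])
      show "?F \<omega> \<in> carrier_mat n n" unfolding F by simp
      show "{L..<n - L} \<subseteq> {..<n}" by auto
      show "x $ i = 0" if "i < n" "i \<notin> {L..<n - L}" for i
        using that supp by (auto simp: C_def)
      fix k assume k': "k \<in> {L..<n - L}"
      have "(\<Sum>j\<in>{L..<n - L}. cmod (?F \<omega> $$ (k, j))) = (\<Sum>j\<in>{L..<n - L}. cmod (?b (int k - int j)))"
        using k' unfolding F by (intro sum.cong) auto
      also have "\<dots> \<le> 2 * e"
        using k k' by (intro strang_defect_row_sum c_uminus tail) auto
      finally show "(\<Sum>j\<in>{L..<n - L}. cmod (?F \<omega> $$ (k, j))) \<le> 2 * e" .
    qed
  qed
qed

theorem theorem20: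
  fixes M :: "'w measure"
    and f :: "'w \<Rightarrow> real \<Rightarrow> real"
    and c :: "int \<Rightarrow> 'w \<Rightarrow> complex"
    and T S :: "nat \<Rightarrow> 'w \<Rightarrow> complex mat"
    and avg :: "nat \<Rightarrow> bool"
    and D :: "'w set"
  defines "D \<equiv> L1_domain M f"
    and "c \<equiv> (\<lambda>n \<omega>. fourier_coeff (f \<omega>) n)"
    and "T \<equiv> (\<lambda>n \<omega>. toeplitz_mat n (\<lambda>l. c l \<omega>))"
    and "S \<equiv> (\<lambda>n \<omega>. strang_mat (avg n) n (\<lambda>l. c l \<omega>))"
  assumes prob: "prob_space M"
    and L1: "AE \<omega> in M. f \<omega> absolutely_integrable_on {-pi..pi}"
    and coeff_measurable: "\<And>n. c n \<in> borel_measurable (restrict_space M D)"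
    and pos: "\<And>\<omega> x. \<omega> \<in> space M \<Longrightarrow> x \<in> {-pi..pi} \<Longrightarrow> 0 < f \<omega> x"
    and T_pos_def: "\<And>n. AE \<omega> in M. hermitian_pos_def (T n \<omega>)"
    and summable: "(\<Sum>\<^sub>\<infinity>n\<in>UNIV. sup_norm_on D (c n)) < \<infinity>"
  shows "\<forall>\<epsilon>>0. \<exists>(K::nat) (N::nat). N > 0 \<and>
           (\<forall>n>N. card {k. k < n \<and>
              sup_norm_on D (eigenvalue_fun (\<lambda>\<omega>. S n \<omega> - T n \<omega>) k) > ennreal \<epsilon>} \<le> K)"
proof (intro allI impI)
  fix \<epsilon> :: real
  assume "0 < \<epsilon>"
  \<comment> \<open>Half of \<open>\<epsilon>\<close>, because a row sum is bounded by two
    tails.\<close>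
  then have "0 < ennreal (\<epsilon> / 2)" by simp
  from ennreal_int_sum_tail[OF summable this] obtain L where L: "\<And>G. finite G \<Longrightarrow> (\<And>i. i \<in> G \<Longrightarrow> int L < \<bar>i\<bar>) \<Longrightarrow>
      (\<Sum>i\<in>G. sup_norm_on D (c i)) \<le> ennreal (\<epsilon> / 2)"
    by blast
  \<comment> \<open>The sup norms dominate the coefficients at each \<open>\<omega>\<close> in
    \<open>D\<close>, so that the same \<open>L\<close> serves everywhere.\<close>
  have tail: "(\<Sum>i\<in>G. cmod (c i \<omega>)) \<le> \<epsilon> / 2"
    if "\<omega> \<in> D" "finite G" "\<And>i. i \<in> G \<Longrightarrow> int L < \<bar>i\<bar>" for \<omega> G
  proof -
    have "ennreal (\<Sum>i\<in>G. cmod (c i \<omega>)) = (\<Sum>i\<in>G. ennreal (cmod (c i \<omega>)))"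
      by (simp add: sum_ennreal)
    also have "\<dots> \<le> (\<Sum>i\<in>G. sup_norm_on D (c i))"
      unfolding sup_norm_on_def using that by (intro sum_mono SUP_upper)
    also have "\<dots> \<le> ennreal (\<epsilon> / 2)" by (rule L) (use that in auto)
    finally show ?thesis using \<open>0 < \<epsilon>\<close> by (simp add: ennreal_le_iff)
  qed
  have bound: "sup_norm_on D (eigenvalue_fun (\<lambda>\<omega>. S n \<omega> - T n \<omega>) k) \<le> ennreal \<epsilon>"
    if k: "2 * L \<le> k" "k + 2 * L < n" for n k
    unfolding sup_norm_on_def
  proof (rule SUP_least)
    fix \<omega> assume "\<omega> \<in> D"
    have "\<bar>eigenvalue_fun (\<lambda>\<omega>. S n \<omega> - T n \<omega>) k \<omega>\<bar> \<le> 2 * (\<epsilon> / 2)"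
      unfolding S_def T_def
      by (rule strang_middle_eigenvalue_bound[where c = c and L = L, OF _ tail k])
        (use \<open>\<omega> \<in> D\<close> in \<open>auto simp: c_def fourier_coeff_uminus\<close>)
    then show "ennreal (norm (eigenvalue_fun (\<lambda>\<omega>. S n \<omega> - T n \<omega>) k \<omega>)) \<le> ennreal \<epsilon>"
      by (intro ennreal_leI) simp
  qed
  have "card {k. k < n \<and> ennreal \<epsilon> < sup_norm_on D (eigenvalue_fun (\<lambda>\<omega>. S n \<omega> - T n \<omega>) k)} \<le> 4 * L" for n
  proof -
    \<comment> \<open>Only the two ends escape \<open>bound\<close>. For \<open>n < 2 * L\<close>
      the truncated difference \<open>n - 2 * L\<close> is 0 and the inclusion still holds.\<close>
    have "{k. k < n \<and> ennreal \<epsilon> < sup_norm_on D (eigenvalue_fun (\<lambda>\<omega>. S n \<omega> - T n \<omega>) k)}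
        \<subseteq> {..<2 * L} \<union> {n - 2 * L..<n}"
      using bound[of _ n] by (force simp flip: not_le)
    then have "card {k. k < n \<and> ennreal \<epsilon> < sup_norm_on D (eigenvalue_fun (\<lambda>\<omega>. S n \<omega> - T n \<omega>) k)}
        \<le> card ({..<2 * L} \<union> {n - 2 * L..<n})"
      by (intro card_mono) auto
    also have "\<dots> \<le> 2 * L + 2 * L"
      by (rule order_trans[OF card_Un_le]) simp
    finally show ?thesis by simp
  qed
  then show "\<exists>(K::nat) (N::nat). N > 0 \<and>
           (\<forall>n>N. card {k. k < n \<and>
              sup_norm_on D (eigenvalue_fun (\<lambda>\<omega>. S n \<omega> - T n \<omega>) k) > ennreal \<epsilon>} \<le> K)"
    \<comment> \<open>The count is at most \<open>4 * L\<close> for every \<open>n\<close>, so any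
      positive \<open>N\<close> will do.\<close>
    by (intro exI[of _ "4 * L"] exI[of _ 1]) auto
qed

end
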